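(* Let $n\ge2$, $m\ge2$, let $\omega=(w_1,\ldots,w_m)$ be a probability vector, and let $A_1,\ldots,A_m\in\mathrm{UT}_n$. Then every solution $X=[x_{p,q}]\in\mathrm{UT}_n$ of the Karcher equation $\sum_{i=1}^m w_i\log(X^{-1}A_i)=0$ satisfies $$\operatorname{diag}(X)=D:=\operatorname{diag}(A_1^{w_1}\cdots A_m^{w_m}).$$ Furthermore, writing $D=\operatorname{diag}(d_1,\ldots,d_n)$ and $D^{-1}A_i=[a_{p,q}^{(i)}]$ for $i=1,\ldots,m$, one has $$x_{p,p+1}=\frac{d_p\sum_{i=1}^m w_i\, f\bigl(a_{p+1,p+1}^{(i)},a_{p,p}^{(i)}\bigr)\,a_{p,p+1}^{(i)}}{\sum_{i=1}^m w_i\, f\bigl(a_{p+1,p+1}^{(i)},a_{p,p}^{(i)}\bigr)\,a_{p+1,p+1}^{(i)}},\qquad p=1,\ldots,n-1.$$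
   Context: $\mathrm{UT}_n$ is the group of $n\times n$ real upper triangular matrices with positive diagonal entries. A probability vector has nonnegative entries summing to $1$. For $A\in\mathrm{UT}_n$, $\log A$ is the principal logarithm (the unique real upper triangular matrix $L$ with $\exp L=A$), and $A^{t}=\exp(t\log A)$ for $t\in\mathbb{R}$. $\operatorname{diag}(A)$ is the diagonal matrix formed from the diagonal entries of $A$, and $\operatorname{diag}(d_1,\ldots,d_n)$ is the diagonal matrix with the given entries. For $x,y>0$, $f(x,y)=\dfrac{\log x-\log y}{x-y}$ if $x\neq y$, and $f(x,x)=1/x$. *)

theory Defs
  imports Complex_Main "Jordan_Normal_Form.Gauss_Jordan_Elimination"
begin

text \<open>Rows, columns and the families \<open>A\<close>, \<open>w\<close> are indexed from \<open>0\<close>: the entry usually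
  written \<open>x\<close> with indices \<open>p, q\<close> (counted from 1) is \<open>X $$ (p - 1, q - 1)\<close>, and
  \<open>A\<close> with index \<open>i\<close> (counted from 1) is \<open>A (i - 1)\<close>.\<close>

definition UT :: "nat \<Rightarrow> real mat set" where
  "UT n = {A \<in> carrier_mat n n. upper_triangular A \<and> (\<forall>i<n. A $$ (i, i) > 0)}"

definition probability_vector :: "nat \<Rightarrow> (nat \<Rightarrow> real) \<Rightarrow> bool" where
  "probability_vector m w \<longleftrightarrow> (\<forall>i<m. w i \<ge> 0) \<and> (\<Sum>i<m. w i) = 1"

text \<open>The type \<open>real mat\<close> carries no topology, so the exponential series is summed entry by
  entry; it converges for every square matrix.\<close>

definition mat_exp :: "real mat \<Rightarrow> real mat" where
  "mat_exp A = mat (dim_row A) (dim_row A) (\<lambda>(i, j). \<Sum>k. (A ^\<^sub>m k) $$ (i, j) / fact k)"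

text \<open>The description is uniquely satisfied on \<open>UT n\<close>; outside \<open>UT n\<close> the value is irrelevant.\<close>

definition mat_log :: "real mat \<Rightarrow> real mat" where
  "mat_log A = (THE L. L \<in> carrier_mat (dim_row A) (dim_row A)
     \<and> upper_triangular L \<and> mat_exp L = A)"

definition mat_powr :: "real mat \<Rightarrow> real \<Rightarrow> real mat" where
  "mat_powr A t = mat_exp (t \<cdot>\<^sub>m mat_log A)"

text \<open>Elements of \<open>UT n\<close> are invertible, so \<^const>\<open>mat_inverse\<close> never returns \<^const>\<open>None\<close> there.\<close>

definition mat_inv :: "real mat \<Rightarrow> real mat" where
  "mat_inv A = the (mat_inverse A)"

definition diag_part :: "real mat \<Rightarrow> real mat" where
  "diag_part A = mat_diag (dim_row A) (\<lambda>i. A $$ (i, i))"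

text \<open>The product \<open>B 0 * B 1 * \<dots> * B (m - 1)\<close>, in this order.\<close>

definition ordered_prod :: "nat \<Rightarrow> nat \<Rightarrow> (nat \<Rightarrow> real mat) \<Rightarrow> real mat" where
  "ordered_prod n m B = foldr (*) (map B [0..<m]) (1\<^sub>m n)"

definition karcher_solution ::
    "nat \<Rightarrow> nat \<Rightarrow> (nat \<Rightarrow> real) \<Rightarrow> (nat \<Rightarrow> real mat) \<Rightarrow> real mat \<Rightarrow> bool" where
  "karcher_solution n m w A X \<longleftrightarrow>
     finsum (module_mat TYPE(real) n n) (\<lambda>i. w i \<cdot>\<^sub>m mat_log (mat_inv X * A i)) {..<m} = 0\<^sub>m n n"

definition log_quot :: "real \<Rightarrow> real \<Rightarrow> real" where
  "log_quot x y = (if x = y then 1 / x else (ln x - ln y) / (x - y))"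

end

(* Entry (i, j) of exp L, for an upper triangular matrix L, is the product of the (i, j) entry
   of L with the first divided difference of exp at the eigenvalues L_ii and L_jj, plus a term
   that only depends on entries closer to the diagonal. Divided differences of exp are positive,
   so the entries of log B are determined one after the other, by increasing distance to the
   diagonal; on the diagonal they are logarithms and on the first superdiagonal
   (log B)_(p,p+1) = f(b_(p+1), b_p) B_(p,p+1). Comparing the diagonals and the first
   superdiagonals in the Karcher equation then gives both claims. *)
theory Submission
  imports Defs "Jordan_Normal_Form.Determinant"
begin

section \<open>Divided differences of the exponential\<close>

text \<open>The first divided difference of \<open>t ^ k\<close> at \<open>x\<close> and
  \<open>y\<close>, that is, the sum of \<open>x ^ a * y ^ b\<close> over
  \<open>a + b = k - 1\<close>. Being free of division it covers \<open>x = y\<close>, and its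
  recursion matches right multiplication in \<open>tri_pow\<close>.\<close>

primrec power_dd :: "real \<Rightarrow> real \<Rightarrow> nat \<Rightarrow> real" where
  "power_dd x y 0 = 0"
| "power_dd x y (Suc k) = x ^ k + power_dd x y k * y"

definition exp_dd :: "real \<Rightarrow> real \<Rightarrow> real" where
  "exp_dd x y = (if x = y then exp x else (exp x - exp y) / (x - y))"

lemma power_dd_mult_diff: "power_dd x y k * (x - y) = x ^ k - y ^ k"
proof (induction k)
  case (Suc k)
  have "power_dd x y (Suc k) * (x - y) = x ^ k * (x - y) + (power_dd x y k * (x - y)) * y"
    by (simp add: algebra_simps)
  also have "\<dots> = x ^ Suc k - y ^ Suc k"
    unfolding Suc.IH by (simp add: algebra_simps)
  finally show ?case .
qed simp

lemma power_dd_same: "power_dd x x (Suc k) = real (Suc k) * x ^ k"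
  by (induction k) (simp_all add: algebra_simps)

lemma exp_sums_real: "(\<lambda>k. x ^ k / fact k) sums exp x" for x :: real
  using exp_converges[of x] by (simp add: field_simps)

text \<open>Divided differences are linear, so they may be taken term by term in the exponential
  series; at coinciding points this is termwise differentiation.\<close>

lemma power_dd_sums: "(\<lambda>k. power_dd x y k / fact k) sums exp_dd x y"
proof (cases "x = y")
  case True
  have "power_dd x x (Suc k) / fact (Suc k) = x ^ k / fact k" for k
    unfolding power_dd_same by (simp add: field_simps del: of_nat_Suc)
  then have "(\<lambda>k. power_dd x x (Suc k) / fact (Suc k)) sums exp x"
    using exp_sums_real[of x] by simp
  \<comment> \<open>Restores the term for exponent 0, which is zero.\<close>
  from sums_Suc[OF this] show ?thesis
    using True by (simp add: exp_dd_def)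
next
  case False
  have "(\<lambda>k. (x ^ k / fact k - y ^ k / fact k) / (x - y)) sums ((exp x - exp y) / (x - y))"
    by (intro sums_divide sums_diff exp_sums_real)
  moreover have "(x ^ k / fact k - y ^ k / fact k) / (x - y) = power_dd x y k / fact k" for k
    unfolding diff_divide_distrib[symmetric] power_dd_mult_diff[symmetric] using False by simp
  ultimately show ?thesis
    using False by (simp add: exp_dd_def)
qed

text \<open>\<open>exp\<close> is strictly increasing, so numerator and denominator have the same
  sign. Positivity is what allows division by \<open>exp_dd\<close> when solving for an entry of the
  logarithm.\<close>

lemma exp_dd_pos: "exp_dd x y > 0"
  by (cases x y rule: linorder_cases) (auto simp: exp_dd_def divide_simps)

text \<open>\<open>log_quot\<close> is the divided difference of \<open>ln\<close>, and difference
  quotients of inverse functions are reciprocal. The exchanged arguments only change the sign of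
  both numerator and denominator.\<close>

lemma log_quot_eq_exp_dd:
  assumes "x > 0" "y > 0"
  shows "log_quot x y = 1 / exp_dd (ln y) (ln x)"
  using assms minus_divide_divide[of "ln y - ln x" "y - x"]
  by (auto simp: log_quot_def exp_dd_def)

lemma log_quot_pos: "x > 0 \<Longrightarrow> y > 0 \<Longrightarrow> log_quot x y > 0"
  by (simp add: log_quot_eq_exp_dd exp_dd_pos)

section \<open>The exponential of triangular arrays\<close>

text \<open>Powers of an upper triangular matrix, encoded as a function without dimension so that
  entries can be changed freely. The sum runs over \<open>i..j\<close> only, so values of
  \<open>l\<close> below the diagonal are never read.\<close>

primrec tri_pow :: "(nat \<Rightarrow> nat \<Rightarrow> real) \<Rightarrow> nat \<Rightarrow> nat \<Rightarrow> nat \<Rightarrow> real" where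
  "tri_pow l 0 i j = of_bool (i = j)"
| "tri_pow l (Suc k) i j = (\<Sum>r=i..j. tri_pow l k i r * l r j)"

definition tri_exp :: "(nat \<Rightarrow> nat \<Rightarrow> real) \<Rightarrow> nat \<Rightarrow> nat \<Rightarrow> real" where
  "tri_exp l i j = (\<Sum>k. tri_pow l k i j / fact k)"

section \<open>Locality and convergence of triangular powers\<close>

lemma tri_pow_below_diagonal: "j < i \<Longrightarrow> tri_pow l k i j = 0"
  by (cases k) auto

lemma tri_pow_diagonal: "tri_pow l k i i = l i i ^ k"
  by (induction k) auto

text \<open>The recursion for the entry at \<open>(i, j)\<close> never leaves the triangle between
  \<open>i\<close> and \<open>j\<close>. This locality is what permits determining entries by
  increasing distance to the diagonal.\<close>

lemma tri_pow_cong: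
  assumes "\<And>r s. i \<le> r \<Longrightarrow> r \<le> s \<Longrightarrow> s \<le> j \<Longrightarrow> l r s = l' r s"
  shows "tri_pow l k i j = tri_pow l' k i j"
  using assms
proof (induction k arbitrary: j)
  case (Suc k)
  have "tri_pow l k i r * l r j = tri_pow l' k i r * l' r j" if "r \<in> {i..j}" for r
    using that Suc.IH[of r] Suc.prems by auto
  then show ?case by simp
qed simp

lemma tri_exp_cong:
  assumes "\<And>r s. i \<le> r \<Longrightarrow> r \<le> s \<Longrightarrow> s \<le> j \<Longrightarrow> l r s = l' r s"
  shows "tri_exp l i j = tri_exp l' i j"
  unfolding tri_exp_def using tri_pow_cong[OF assms] by simp

text \<open>Each multiplication by \<open>l\<close> sums at most \<open>n + 1\<close> terms and
  contributes a factor of size at most \<open>M\<close>.\<close>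

lemma tri_pow_bound:
  assumes "\<And>r s. r \<le> n \<Longrightarrow> s \<le> n \<Longrightarrow> \<bar>l r s\<bar> \<le> M" "j \<le> n"
  shows "\<bar>tri_pow l k i j\<bar> \<le> (real (Suc n) * M) ^ k"
  using assms(2)
proof (induction k arbitrary: j)
  case (Suc k)
  have M: "M \<ge> 0"
    using assms(1)[of 0 0] by simp
  have "\<bar>tri_pow l (Suc k) i j\<bar> \<le> (\<Sum>r=i..j. \<bar>tri_pow l k i r * l r j\<bar>)"
    by simp
  also have "\<dots> \<le> (\<Sum>r=i..j. (real (Suc n) * M) ^ k * M)"
    using Suc assms(1) M by (intro sum_mono) (simp add: abs_mult mult_mono)
  also have "\<dots> \<le> (\<Sum>r\<in>{..n}. (real (Suc n) * M) ^ k * M)"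
    using Suc.prems M by (intro sum_mono2) auto
  also have "\<dots> = (real (Suc n) * M) ^ Suc k"
    by simp
  finally show ?case .
qed simp

lemma summable_tri_pow: "summable (\<lambda>k. tri_pow l k i j / fact k)"
proof -
  \<comment> \<open>A sum of absolute values serves as a common bound; only indices up to
    \<open>j\<close> enter column \<open>j\<close>.\<close>
  define M where "M = (\<Sum>r\<le>j. \<Sum>s\<le>j. \<bar>l r s\<bar>)"
  have M: "\<bar>l r s\<bar> \<le> M" if "r \<le> j" "s \<le> j" for r s
  proof -
    have "\<bar>l r s\<bar> \<le> (\<Sum>s\<le>j. \<bar>l r s\<bar>)"
      using that by (intro member_le_sum) auto
    also have "\<dots> \<le> M"
      unfolding M_def using that
      by (intro member_le_sum[where f = "\<lambda>r. \<Sum>s\<le>j. \<bar>l r s\<bar>"]) (auto intro: sum_nonneg)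
    finally show ?thesis .
  qed
  show ?thesis
  proof (rule summable_comparison_test')
    show "summable (\<lambda>k. (real (Suc j) * M) ^ k / fact k)"
      using exp_sums_real sums_summable by blast
    show "norm (tri_pow l k i j / fact k) \<le> (real (Suc j) * M) ^ k / fact k" for k
      using tri_pow_bound[where k = k and i = i, OF M order.refl] by (simp add: divide_right_mono)
  qed
qed

lemma tri_exp_sums: "(\<lambda>k. tri_pow l k i j / fact k) sums tri_exp l i j"
  unfolding tri_exp_def by (rule summable_sums[OF summable_tri_pow])

lemma tri_exp_diagonal: "tri_exp l i i = exp (l i i)"
  using sums_unique2[OF tri_exp_sums[of l i i]] exp_sums_real[of "l i i"] by (simp add: tri_pow_diagonal)

lemma tri_exp_below_diagonal: "j < i \<Longrightarrow> tri_exp l i j = 0"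
  by (simp add: tri_exp_def tri_pow_below_diagonal)

text \<open>Expand the power over nondecreasing paths from \<open>i\<close> to \<open>j\<close>. A
  path using the entry \<open>(i, j)\<close> uses it once, waiting at \<open>i\<close> before and at
  \<open>j\<close> after; the weights of the waiting times add up to
  \<open>power_dd\<close>.\<close>

lemma tri_pow_diff:
  assumes "i < j"
    and agree: "\<And>r s. i \<le> r \<Longrightarrow> r \<le> s \<Longrightarrow> s \<le> j \<Longrightarrow> (r, s) \<noteq> (i, j) \<Longrightarrow> l r s = l' r s"
  shows "tri_pow l k i j - tri_pow l' k i j = (l i j - l' i j) * power_dd (l i i) (l j j) k"
proof (induction k)
  case (Suc k)
  have split: "tri_pow g (Suc k) i j
      = g i i ^ k * g i j + (\<Sum>r\<in>{i<..<j}. tri_pow g k i r * g r j) + tri_pow g k i j * g j j"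
    for g
  proof -
    have "{i..j} = insert i (insert j {i<..<j})"
      using assms(1) by auto
    then show ?thesis
      using assms(1) by (simp add: tri_pow_diagonal)
  qed
  \<comment> \<open>For \<open>r\<close> strictly inside, both factors depend only on entries on
    which \<open>l\<close> and \<open>l'\<close> agree.\<close>
  have inner: "(\<Sum>r\<in>{i<..<j}. tri_pow l k i r * l r j) = (\<Sum>r\<in>{i<..<j}. tri_pow l' k i r * l' r j)"
  proof (rule sum.cong[OF refl])
    fix r assume r: "r \<in> {i<..<j}"
    have "tri_pow l k i r = tri_pow l' k i r"
      using r agree by (intro tri_pow_cong) auto
    then show "tri_pow l k i r * l r j = tri_pow l' k i r * l' r j"
      using r agree by auto
  qed
  have diag: "l' i i = l i i" "l' j j = l j j"
    using assms(1) agree[of i i] agree[of j j] by auto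
  have "tri_pow l (Suc k) i j - tri_pow l' (Suc k) i j
      = l i i ^ k * (l i j - l' i j) + (tri_pow l k i j - tri_pow l' k i j) * l j j"
    unfolding split[of l] split[of l'] inner diag by (simp add: algebra_simps)
  also have "\<dots> = (l i j - l' i j) * power_dd (l i i) (l j j) (Suc k)"
    unfolding Suc.IH by (simp add: algebra_simps)
  finally show ?case .
qed simp

text \<open>Summation of the differences of the powers. With the other entries of the triangle
  fixed, the entry of the exponential is affine in \<open>l i j\<close> with positive slope, hence
  can be solved for \<open>l i j\<close>.\<close>

lemma tri_exp_diff:
  assumes "i < j"
    and "\<And>r s. i \<le> r \<Longrightarrow> r \<le> s \<Longrightarrow> s \<le> j \<Longrightarrow> (r, s) \<noteq> (i, j) \<Longrightarrow> l r s = l' r s"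
  shows "tri_exp l i j - tri_exp l' i j = (l i j - l' i j) * exp_dd (l i i) (l j j)"
proof -
  have "(\<lambda>k. tri_pow l k i j / fact k - tri_pow l' k i j / fact k)
      sums (tri_exp l i j - tri_exp l' i j)"
    by (intro sums_diff tri_exp_sums)
  moreover have "tri_pow l k i j / fact k - tri_pow l' k i j / fact k
      = (l i j - l' i j) * (power_dd (l i i) (l j j) k / fact k)" for k
    using tri_pow_diff[where k = k, OF assms] by (simp flip: diff_divide_distrib)
  ultimately show ?thesis
    using sums_unique2[OF _ sums_mult[OF power_dd_sums]] by simp
qed

text \<open>No index lies strictly between \<open>i\<close> and \<open>Suc i\<close>, so there is no
  contribution from inner entries.\<close>

lemma tri_pow_superdiagonal: "tri_pow l k i (Suc i) = l i (Suc i) * power_dd (l i i) (l (Suc i) (Suc i)) k"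
proof (induction k)
  case (Suc k)
  then show ?case
    by (simp add: tri_pow_diagonal algebra_simps)
qed simp

lemma tri_exp_superdiagonal: "tri_exp l i (Suc i) = l i (Suc i) * exp_dd (l i i) (l (Suc i) (Suc i))"
proof -
  have "(\<lambda>k. l i (Suc i) * (power_dd (l i i) (l (Suc i) (Suc i)) k / fact k)) sums tri_exp l i (Suc i)"
    using tri_exp_sums[of l i "Suc i"] by (simp add: tri_pow_superdiagonal)
  then show ?thesis
    using sums_unique2 sums_mult[OF power_dd_sums] by blast
qed

section \<open>Bijectivity of the triangular exponential\<close>

lemma tri_exp_inj:
  assumes "\<And>i j. i \<le> j \<Longrightarrow> j < n \<Longrightarrow> tri_exp l i j = tri_exp l' i j"
  shows "i \<le> j \<Longrightarrow> j < n \<Longrightarrow> l i j = l' i j"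
proof (induction "j - i" arbitrary: i j rule: less_induct)
  case less
  show ?case
  proof (cases "i = j")
    case True
    then show ?thesis
      using assms[of i i] less.prems by (simp add: tri_exp_diagonal)
  next
    case False
    \<comment> \<open>Every other position of the triangle has smaller distance to the diagonal, so
      the induction hypothesis applies.\<close>
    have "l r s = l' r s" if "i \<le> r" "r \<le> s" "s \<le> j" "(r, s) \<noteq> (i, j)" for r s
      using that less.prems by (intro less.hyps) auto
    then have "(l i j - l' i j) * exp_dd (l i i) (l j j) = 0"
      using tri_exp_diff[of i j l l'] assms[of i j] less.prems False by simp
    then show ?thesis
      using exp_dd_pos[of "l i i" "l j j"] by simp
  qed
qed

text \<open>The preimage is built one diagonal at a time: \<open>d\<close> is the distance up to
  which the exponential already equals \<open>b\<close>.\<close>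

lemma tri_exp_surj:
  assumes "\<And>i. i < n \<Longrightarrow> b i i > 0"
  shows "\<exists>l. \<forall>i j. i \<le> j \<longrightarrow> j < n \<longrightarrow> tri_exp l i j = b i j"
proof -
  have "\<exists>l. \<forall>i j. i \<le> j \<longrightarrow> j < n \<longrightarrow> j \<le> i + d \<longrightarrow> tri_exp l i j = b i j" for d
  proof (induction d)
    case 0
    show ?case
      using assms by (intro exI[of _ "\<lambda>i j. ln (b i i)"]) (auto simp: tri_exp_diagonal)
  next
    case (Suc d)
    then obtain l where
      l: "\<And>i j. i \<le> j \<Longrightarrow> j < n \<Longrightarrow> j \<le> i + d \<Longrightarrow> tri_exp l i j = b i j"
      by blast
    \<comment> \<open>The correction solves the affine equation of \<open>tri_exp_diff\<close> at
      distance \<open>d + 1\<close>; all other diagonals keep their values.\<close>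
    define l' where "l' i j = (if j = Suc (i + d)
      then l i j + (b i j - tri_exp l i j) / exp_dd (l i i) (l j j) else l i j)" for i j
    have "tri_exp l' i j = b i j" if ij: "i \<le> j" "j < n" "j \<le> i + Suc d" for i j
    proof (cases "j = Suc (i + d)")
      case True
      \<comment> \<open>Within the triangle of \<open>(i, j)\<close>, only the corner
        \<open>(i, j)\<close> has distance \<open>d + 1\<close>.\<close>
      have "tri_exp l' i j - tri_exp l i j = (l' i j - l i j) * exp_dd (l' i i) (l' j j)"
        using True by (intro tri_exp_diff) (auto simp: l'_def)
      also have "\<dots> = b i j - tri_exp l i j"
        using True exp_dd_pos[of "l i i" "l j j"] by (simp add: l'_def)
      finally show ?thesis by simp
    next
      case False
      then have "tri_exp l' i j = tri_exp l i j"
        using ij by (intro tri_exp_cong) (auto simp: l'_def)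
      then show ?thesis
        using l[of i j] ij False by simp
    qed
    then show ?case by blast
  qed
  \<comment> \<open>Distance \<open>n\<close> covers all positions, since
    \<open>j < n\<close>.\<close>
  from this[of n] show ?thesis
    by (metis trans_le_add2 less_imp_le)
qed

section \<open>Upper triangular matrices\<close>

lemma UT_carrier: "A \<in> UT n \<Longrightarrow> A \<in> carrier_mat n n"
  and UT_upper_triangular: "A \<in> UT n \<Longrightarrow> upper_triangular A"
  and UT_diagonal_pos: "A \<in> UT n \<Longrightarrow> i < n \<Longrightarrow> A $$ (i, i) > 0"
  by (auto simp: UT_def)

text \<open>Outside \<open>i..j\<close> one of the two factors lies below the diagonal. The
  truncated sum has the shape of the recursion of \<open>tri_pow\<close>, and it is empty for
  \<open>j < i\<close>.\<close>

lemma upper_triangular_mult_index: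
  fixes A B :: "real mat"
  assumes A: "A \<in> carrier_mat n n" "upper_triangular A"
    and B: "B \<in> carrier_mat n n" "upper_triangular B"
    and ij: "i < n" "j < n"
  shows "(A * B) $$ (i, j) = (\<Sum>r=i..j. A $$ (i, r) * B $$ (r, j))"
proof -
  have "(A * B) $$ (i, j) = (\<Sum>r\<in>{0..<n}. A $$ (i, r) * B $$ (r, j))"
    using A B ij by (simp add: scalar_prod_def)
  also have "\<dots> = (\<Sum>r=i..j. A $$ (i, r) * B $$ (r, j))"
  proof (rule sum.mono_neutral_right)
    show "\<forall>r\<in>{0..<n} - {i..j}. A $$ (i, r) * B $$ (r, j) = 0"
    proof
      fix r assume "r \<in> {0..<n} - {i..j}"
      then have "r < i \<or> j < r \<and> r < n" by auto
      then show "A $$ (i, r) * B $$ (r, j) = 0"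
        using A B ij by (auto dest: upper_triangularD)
    qed
  qed (use ij in auto)
  finally show ?thesis .
qed

lemma UT_mult:
  assumes "A \<in> UT n" "B \<in> UT n"
  shows "A * B \<in> UT n"
    and UT_mult_diagonal: "i < n \<Longrightarrow> (A * B) $$ (i, i) = A $$ (i, i) * B $$ (i, i)"
    and UT_mult_superdiagonal: "Suc i < n \<Longrightarrow>
      (A * B) $$ (i, Suc i) = A $$ (i, i) * B $$ (i, Suc i) + A $$ (i, Suc i) * B $$ (Suc i, Suc i)"
proof -
  note AB = assms[THEN UT_carrier] assms[THEN UT_upper_triangular]
  have index: "(A * B) $$ (i, j) = (\<Sum>r=i..j. A $$ (i, r) * B $$ (r, j))" if "i < n" "j < n" for i j
    using upper_triangular_mult_index AB that by blast
  show diagonal: "(A * B) $$ (i, i) = A $$ (i, i) * B $$ (i, i)" if "i < n" for i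
    using index that by simp
  show "(A * B) $$ (i, Suc i) = A $$ (i, i) * B $$ (i, Suc i) + A $$ (i, Suc i) * B $$ (Suc i, Suc i)"
    if "Suc i < n"
    using index that by simp
  have "upper_triangular (A * B)"
  proof
    fix i j assume "j < i" "i < dim_row (A * B)"
    then show "(A * B) $$ (i, j) = 0"
      using index[of i j] AB(1) by simp
  qed
  then show "A * B \<in> UT n"
    using AB(1,2) diagonal UT_diagonal_pos[OF assms(1)] UT_diagonal_pos[OF assms(2)]
    by (auto simp: UT_def)
qed

section \<open>Inverses of triangular matrices\<close>

lemma UT_mat_inv:
  assumes "A \<in> UT n"
  shows "mat_inv A \<in> UT n" and UT_mat_inv_mult: "mat_inv A * A = 1\<^sub>m n"
proof -
  note A = UT_carrier[OF assms] UT_upper_triangular[OF assms]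
  \<comment> \<open>The determinant is the product of the positive diagonal entries, so
    \<open>mat_inverse\<close> does return a matrix.\<close>
  have "det A \<noteq> 0"
  proof -
    have "det A = (\<Prod>i<n. A $$ (i, i))"
      using A by (simp add: det_upper_triangular diag_mat_def prod.list_conv_set_nth
          lessThan_atLeast0)
    also have "\<dots> > 0"
      using UT_diagonal_pos[OF assms] by (intro prod_pos) auto
    finally show ?thesis by simp
  qed
  then have "mat_inverse A \<noteq> None"
    using mat_inverse(1)[OF A(1), of n] det_non_zero_imp_unit[OF A(1), of n] by blast
  then have "mat_inverse A = Some (mat_inv A)"
    by (simp add: mat_inv_def)
  from mat_inverse(2)[OF A(1) this] have inv: "mat_inv A * A = 1\<^sub>m n" and
    carrier: "mat_inv A \<in> carrier_mat n n"
    by auto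
  show "mat_inv A * A = 1\<^sub>m n" by (fact inv)
  let ?B = "mat_inv A"
  have sum: "(\<Sum>r\<in>{0..<n}. ?B $$ (i, r) * A $$ (r, j)) = of_bool (i = j)" if "i < n" "j < n" for i j
  proof -
    have "(\<Sum>r\<in>{0..<n}. ?B $$ (i, r) * A $$ (r, j)) = (?B * A) $$ (i, j)"
      using A carrier that by (simp add: scalar_prod_def)
    then show ?thesis
      using that by (simp add: inv)
  qed
  \<comment> \<open>Induction along row \<open>i\<close>: in the vanishing entry
    \<open>(i, j)\<close> of \<open>?B * A\<close>, columns before \<open>j\<close> drop out by
    induction and rows of \<open>A\<close> after \<open>j\<close> by triangularity, leaving
    \<open>?B $$ (i, j) * A $$ (j, j) = 0\<close>.\<close>
  have below: "?B $$ (i, j) = 0" if "j < i" "i < n" for i j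
    using that
  proof (induction j rule: less_induct)
    case (less j)
    have "(\<Sum>r\<in>{0..<n}. ?B $$ (i, r) * A $$ (r, j)) = (\<Sum>r\<in>{j}. ?B $$ (i, r) * A $$ (r, j))"
    proof (rule sum.mono_neutral_right)
      show "\<forall>r\<in>{0..<n} - {j}. ?B $$ (i, r) * A $$ (r, j) = 0"
      proof
        fix r assume r: "r \<in> {0..<n} - {j}"
        show "?B $$ (i, r) * A $$ (r, j) = 0"
        proof (cases "r < j")
          case True
          then show ?thesis using less by simp
        next
          case False
          then have "A $$ (r, j) = 0"
            using r A by (intro upper_triangularD) auto
          then show ?thesis by simp
        qed
      qed
    qed (use less.prems in auto)
    then show ?case
      using sum[of i j] less.prems UT_diagonal_pos[OF assms, of j] by simp
  qed
  have triangular: "upper_triangular ?B"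
    using below carrier by auto
  have "?B $$ (i, i) > 0" if "i < n" for i
  proof -
    have "?B $$ (i, i) * A $$ (i, i) = 1"
      using upper_triangular_mult_index[OF carrier triangular A that that] that by (simp add: inv)
    then have "0 < ?B $$ (i, i) * A $$ (i, i)"
      by simp
    then show ?thesis
      using UT_diagonal_pos[OF assms that] by (simp add: zero_less_mult_iff)
  qed
  then show "?B \<in> UT n"
    using carrier triangular by (simp add: UT_def)
qed

lemma UT_mat_inv_diagonal:
  assumes "A \<in> UT n" "i < n"
  shows "mat_inv A $$ (i, i) = 1 / A $$ (i, i)"
  using UT_mult_diagonal[OF UT_mat_inv(1)[OF assms(1)] assms] UT_mat_inv_mult[OF assms(1)]
    UT_diagonal_pos[OF assms] assms(2)
  by (simp add: field_simps)

text \<open>The superdiagonal entry of \<open>mat_inv A * A\<close> is zero and involves only one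
  unknown.\<close>

lemma UT_mat_inv_superdiagonal:
  assumes "A \<in> UT n" "Suc i < n"
  shows "mat_inv A $$ (i, Suc i) = - A $$ (i, Suc i) / (A $$ (i, i) * A $$ (Suc i, Suc i))"
proof -
  have "mat_inv A $$ (i, i) * A $$ (i, Suc i) + mat_inv A $$ (i, Suc i) * A $$ (Suc i, Suc i) = 0"
    using UT_mult_superdiagonal[OF UT_mat_inv(1)[OF assms(1)] assms] assms(2)
      UT_mat_inv_mult[OF assms(1)] by simp
  moreover have "A $$ (i, i) > 0" "A $$ (Suc i, Suc i) > 0"
    using UT_diagonal_pos[OF assms(1)] assms(2) by auto
  ultimately show ?thesis
    using assms UT_mat_inv_diagonal[OF assms(1), of i] by (simp add: field_simps add_eq_0_iff)
qed

section \<open>Diagonal parts, ordered products and matrix sums\<close>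

lemma UT_diag_part: "A \<in> UT n \<Longrightarrow> diag_part A \<in> UT n"
  and diag_part_index: "A \<in> UT n \<Longrightarrow> i < n \<Longrightarrow> j < n \<Longrightarrow>
    diag_part A $$ (i, j) = (if i = j then A $$ (i, i) else 0)"
  by (auto simp: UT_def diag_part_def mat_diag_def)

lemma UT_one: "1\<^sub>m n \<in> UT n"
  by (auto simp: UT_def)

lemma UT_ordered_prod:
  assumes "\<And>i. i < m \<Longrightarrow> B i \<in> UT n"
  shows "ordered_prod n m B \<in> UT n"
    and ordered_prod_diagonal:
      "p < n \<Longrightarrow> ordered_prod n m B $$ (p, p) = (\<Prod>i<m. B i $$ (p, p))"
proof -
  \<comment> \<open>Both claims go through one list induction, since the diagonal of a product
    factorises only once the tail is known to lie in \<open>UT n\<close>.\<close>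
  have "foldr (*) Bs (1\<^sub>m n) \<in> UT n \<and> (\<forall>p<n. foldr (*) Bs (1\<^sub>m n) $$ (p, p) = (\<Prod>M\<leftarrow>Bs. M $$ (p, p)))"
    if "set Bs \<subseteq> UT n" for Bs :: "real mat list"
    using that by (induction Bs) (auto simp: UT_one UT_mult(1) UT_mult_diagonal simp del: index_mult_mat(1))
  moreover have "set (map B [0..<m]) \<subseteq> UT n"
    using assms by auto
  ultimately have *: "ordered_prod n m B \<in> UT n"
    "\<forall>p<n. ordered_prod n m B $$ (p, p) = (\<Prod>M\<leftarrow>map B [0..<m]. M $$ (p, p))"
    unfolding ordered_prod_def by blast+
  then show "ordered_prod n m B \<in> UT n" by simp
  show "p < n \<Longrightarrow> ordered_prod n m B $$ (p, p) = (\<Prod>i<m. B i $$ (p, p))"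
    using * by (simp add: comp_def prod.list_conv_set_nth lessThan_atLeast0)
qed

text \<open>Turns the matrix sum of the Karcher equation into real sums, one for each entry.\<close>

lemma finsum_mat_index:
  fixes f :: "'b \<Rightarrow> 'a :: comm_ring_1 mat"
  assumes "finite S" "\<And>s. s \<in> S \<Longrightarrow> f s \<in> carrier_mat nr nc" "i < nr" "j < nc"
  shows "finsum (module_mat TYPE('a) nr nc) f S $$ (i, j) = (\<Sum>s\<in>S. f s $$ (i, j))"
proof -
  interpret abelian_group "module_mat TYPE('a) nr nc"
    by (rule abelian_group_mat)
  show ?thesis
    using assms(1,2)
  proof (induction S)
    case empty
    then show ?case
      using assms(3,4) by (simp add: module_mat_simps)
  next
    case (insert s S)
    then have "finsum (module_mat TYPE('a) nr nc) f S \<in> carrier_mat nr nc"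
      using finsum_closed[of f S] by (auto simp: module_mat_simps)
    moreover have "finsum (module_mat TYPE('a) nr nc) f (insert s S)
        = f s + finsum (module_mat TYPE('a) nr nc) f S"
      using insert finsum_insert[of S s f] by (auto simp: module_mat_simps)
    ultimately show ?case
      using insert assms(3,4) by simp
  qed
qed

section \<open>Exponentials and logarithms of upper triangular matrices\<close>

lemma upper_triangular_pow_index:
  fixes L :: "real mat"
  assumes L: "L \<in> carrier_mat n n" "upper_triangular L"
  shows "i < n \<Longrightarrow> j < n \<Longrightarrow> (L ^\<^sub>m k) $$ (i, j) = tri_pow (\<lambda>i j. L $$ (i, j)) k i j"
proof (induction k arbitrary: i j)
  case (Suc k)
  \<comment> \<open>The induction hypothesis itself gives triangularity, as \<open>tri_pow\<close>
    vanishes below the diagonal.\<close>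
  have "upper_triangular (L ^\<^sub>m k)"
    using Suc.IH L by (auto simp: tri_pow_below_diagonal)
  then have "(L ^\<^sub>m Suc k) $$ (i, j) = (\<Sum>r=i..j. (L ^\<^sub>m k) $$ (i, r) * L $$ (r, j))"
    using upper_triangular_mult_index[OF _ _ L Suc.prems] L by simp
  then show ?case
    using Suc by simp
qed (use L in auto)

lemma upper_triangular_exp_index:
  assumes "L \<in> carrier_mat n n" "upper_triangular L" "i < n" "j < n"
  shows "mat_exp L $$ (i, j) = tri_exp (\<lambda>i j. L $$ (i, j)) i j"
  using assms by (simp add: mat_exp_def tri_exp_def upper_triangular_pow_index)

lemma mat_exp_carrier: "L \<in> carrier_mat n n \<Longrightarrow> mat_exp L \<in> carrier_mat n n"
  by (simp add: mat_exp_def)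

lemma UT_mat_exp:
  assumes "L \<in> carrier_mat n n" "upper_triangular L"
  shows "mat_exp L \<in> UT n"
  using assms mat_exp_carrier[OF assms(1)]
  by (auto simp: UT_def upper_triangular_exp_index[OF assms] tri_exp_diagonal tri_exp_below_diagonal)

section \<open>Existence and uniqueness of the triangular logarithm\<close>

lemma mat_exp_inj:
  assumes L: "L \<in> carrier_mat n n" "upper_triangular L"
    and L': "L' \<in> carrier_mat n n" "upper_triangular L'"
    and "mat_exp L = mat_exp L'"
  shows "L = L'"
proof (rule eq_matI)
  fix i j assume "i < dim_row L'" "j < dim_col L'"
  then have ij: "i < n" "j < n" using L' by auto
  show "L $$ (i, j) = L' $$ (i, j)"
  proof (cases "i \<le> j")
    case True
    show ?thesis
    proof (rule tri_exp_inj[OF _ True ij(2)])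
      fix i j assume "i \<le> j" "j < n"
      then show "tri_exp (\<lambda>i j. L $$ (i, j)) i j = tri_exp (\<lambda>i j. L' $$ (i, j)) i j"
        using upper_triangular_exp_index[OF L, of i j] upper_triangular_exp_index[OF L', of i j] assms(5)
        by simp
    qed
  next
    case False
    then show ?thesis
      using upper_triangularD[OF L(2), of j i] upper_triangularD[OF L'(2), of j i] ij L L' by simp
  qed
qed (use L L' in auto)

lemma mat_exp_surj:
  assumes "B \<in> UT n"
  obtains L where "L \<in> carrier_mat n n" "upper_triangular L" "mat_exp L = B"
proof -
  obtain l where l: "\<And>i j. i \<le> j \<Longrightarrow> j < n \<Longrightarrow> tri_exp l i j = B $$ (i, j)"
    using tri_exp_surj[of n "\<lambda>i j. B $$ (i, j)"] UT_diagonal_pos[OF assms] by blast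
  \<comment> \<open>The array \<open>l\<close> is arbitrary below the diagonal; replacing it by zero
    there leaves \<open>tri_exp\<close> unchanged.\<close>
  define L where "L = mat n n (\<lambda>(i, j). if i \<le> j then l i j else 0)"
  have L: "L \<in> carrier_mat n n" "upper_triangular L"
    by (auto simp: L_def)
  have "mat_exp L = B"
  proof (rule eq_matI)
    fix i j assume "i < dim_row B" "j < dim_col B"
    then have ij: "i < n" "j < n" using UT_carrier[OF assms] by auto
    show "mat_exp L $$ (i, j) = B $$ (i, j)"
    proof (cases "i \<le> j")
      case True
      have "tri_exp (\<lambda>i j. L $$ (i, j)) i j = tri_exp l i j"
        using ij by (intro tri_exp_cong) (simp add: L_def)
      then show ?thesis
        using upper_triangular_exp_index[OF L ij] l True ij by simp
    next
      case False
      then show ?thesis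
        using upper_triangular_exp_index[OF L ij] UT_carrier[OF assms] ij
          upper_triangularD[OF UT_upper_triangular[OF assms], of j i]
        by (simp add: tri_exp_below_diagonal)
    qed
  qed (use mat_exp_carrier[OF L(1)] UT_carrier[OF assms] in auto)
  with L that show ?thesis by blast
qed

text \<open>Existence and uniqueness of a triangular preimage under \<open>mat_exp\<close> give the
  definite description its meaning.\<close>

lemma UT_mat_log:
  assumes "B \<in> UT n"
  shows mat_log_carrier: "mat_log B \<in> carrier_mat n n"
    and mat_log_upper_triangular: "upper_triangular (mat_log B)"
    and mat_exp_mat_log: "mat_exp (mat_log B) = B"
proof -
  have dim: "dim_row B = n"
    using UT_carrier[OF assms] by simp
  obtain L where "L \<in> carrier_mat n n" "upper_triangular L" "mat_exp L = B"
    using mat_exp_surj[OF assms] .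
  then have "\<exists>!L. L \<in> carrier_mat n n \<and> upper_triangular L \<and> mat_exp L = B"
    using mat_exp_inj by metis
  from theI'[OF this] show "mat_log B \<in> carrier_mat n n" "upper_triangular (mat_log B)"
    "mat_exp (mat_log B) = B"
    unfolding mat_log_def dim by auto
qed

lemma mat_log_diagonal:
  assumes "B \<in> UT n" "i < n"
  shows "mat_log B $$ (i, i) = ln (B $$ (i, i))"
  using upper_triangular_exp_index[OF mat_log_carrier mat_log_upper_triangular, OF assms(1) assms(1), of i i]
    assms by (simp add: mat_exp_mat_log tri_exp_diagonal)

text \<open>Solves \<open>tri_exp_superdiagonal\<close> for the entry of the logarithm; the slope is
  the reciprocal of \<open>log_quot\<close>.\<close>

lemma mat_log_superdiagonal:
  assumes "B \<in> UT n" "Suc i < n"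
  shows "mat_log B $$ (i, Suc i)
    = log_quot (B $$ (Suc i, Suc i)) (B $$ (i, i)) * B $$ (i, Suc i)"
proof -
  have "B $$ (i, Suc i)
      = mat_log B $$ (i, Suc i) * exp_dd (mat_log B $$ (i, i)) (mat_log B $$ (Suc i, Suc i))"
    using upper_triangular_exp_index[OF mat_log_carrier mat_log_upper_triangular,
        OF assms(1) assms(1), of i "Suc i"] assms
    by (simp add: mat_exp_mat_log tri_exp_superdiagonal)
  then show ?thesis
    using assms UT_diagonal_pos[OF assms(1), of i] UT_diagonal_pos[OF assms(1), of "Suc i"]
      exp_dd_pos[of "ln (B $$ (i, i))" "ln (B $$ (Suc i, Suc i))"]
    by (simp add: mat_log_diagonal log_quot_eq_exp_dd)
qed

lemma UT_mat_powr:
  assumes "B \<in> UT n"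
  shows "mat_powr B t \<in> UT n"
    and mat_powr_diagonal: "i < n \<Longrightarrow> mat_powr B t $$ (i, i) = B $$ (i, i) powr t"
proof -
  have L: "t \<cdot>\<^sub>m mat_log B \<in> carrier_mat n n" "upper_triangular (t \<cdot>\<^sub>m mat_log B)"
    using mat_log_carrier[OF assms] upper_triangularD[OF mat_log_upper_triangular[OF assms]]
    by auto
  show "mat_powr B t \<in> UT n"
    unfolding mat_powr_def by (rule UT_mat_exp[OF L])
  show "mat_powr B t $$ (i, i) = B $$ (i, i) powr t" if "i < n"
    using upper_triangular_exp_index[OF L that that] mat_log_carrier[OF assms] that
      UT_diagonal_pos[OF assms that]
    by (simp add: mat_powr_def tri_exp_diagonal mat_log_diagonal[OF assms] powr_def)
qed

section \<open>The Karcher equation\<close>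

lemma karcher_solution_entry:
  assumes "karcher_solution n m w A X" "X \<in> UT n" "\<And>i. i < m \<Longrightarrow> A i \<in> UT n" "p < n" "q < n"
  shows "(\<Sum>i<m. w i * mat_log (mat_inv X * A i) $$ (p, q)) = 0"
proof -
  have log: "mat_log (mat_inv X * A i) \<in> carrier_mat n n" if "i < m" for i
    using mat_log_carrier[OF UT_mult(1)[OF UT_mat_inv(1)]] assms(2,3) that by blast
  have "(\<Sum>i<m. w i * mat_log (mat_inv X * A i) $$ (p, q))
      = (\<Sum>i<m. (w i \<cdot>\<^sub>m mat_log (mat_inv X * A i)) $$ (p, q))"
    using log[THEN carrier_matD(1)] log[THEN carrier_matD(2)] assms(4,5) by simp
  also have "\<dots> = finsum (module_mat TYPE(real) n n)
      (\<lambda>i. w i \<cdot>\<^sub>m mat_log (mat_inv X * A i)) {..<m} $$ (p, q)"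
    using log assms(4,5) by (intro finsum_mat_index[symmetric]) auto
  also have "\<dots> = 0"
    using assms(1,4,5) by (simp add: karcher_solution_def)
  finally show ?thesis .
qed

text \<open>On the diagonal the logarithm of the product is a difference of real logarithms. As the
  weights sum to 1, \<open>ln (X $$ (p, p))\<close> is the weighted mean of the logarithms of the
  entries of the \<open>A i\<close>.\<close>

lemma karcher_solution_diagonal:
  assumes "karcher_solution n m w A X" "X \<in> UT n" "\<And>i. i < m \<Longrightarrow> A i \<in> UT n"
    and "probability_vector m w" "p < n"
  shows "X $$ (p, p) = (\<Prod>i<m. A i $$ (p, p) powr w i)"
proof -
  have X: "X $$ (p, p) > 0"
    by (rule UT_diagonal_pos[OF assms(2,5)])
  have A: "A i $$ (p, p) > 0" if "i < m" for i
    using UT_diagonal_pos[OF assms(3) assms(5)] that .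
  have "mat_log (mat_inv X * A i) $$ (p, p) = ln (A i $$ (p, p)) - ln (X $$ (p, p))"
    if "i < m" for i
    using assms(2,3,5) that X A[OF that]
    by (simp add: mat_log_diagonal[of _ n] UT_mult(1)[of _ n] UT_mat_inv(1) UT_mult_diagonal[of _ n]
        UT_mat_inv_diagonal[of _ n] ln_div del: index_mult_mat(1))
  then have "(\<Sum>i<m. w i * (ln (A i $$ (p, p)) - ln (X $$ (p, p)))) = 0"
    using karcher_solution_entry[OF assms(1-3) assms(5,5)] by simp
  then have "(\<Sum>i<m. w i * ln (A i $$ (p, p))) = (\<Sum>i<m. w i) * ln (X $$ (p, p))"
    by (simp add: right_diff_distrib sum_subtractf sum_distrib_right)
  then have "ln (X $$ (p, p)) = (\<Sum>i<m. w i * ln (A i $$ (p, p)))"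
    using assms(4) by (simp add: probability_vector_def)
  then have "X $$ (p, p) = exp (\<Sum>i<m. w i * ln (A i $$ (p, p)))"
    using X by (metis exp_ln)
  also have "\<dots> = (\<Prod>i<m. A i $$ (p, p) powr w i)"
    using A by (simp add: exp_sum powr_def less_imp_neq[symmetric])
  finally show ?thesis .
qed

text \<open>Replacing \<open>X\<close> by its diagonal part keeps the diagonal of
  \<open>mat_inv X * A i\<close>, hence the factors \<open>f i\<close>. The superdiagonal entry
  changes by a multiple of \<open>X $$ (p, Suc p)\<close>, so the equation is linear in that
  unknown.\<close>

lemma karcher_solution_superdiagonal:
  assumes "karcher_solution n m w A X" "X \<in> UT n" "\<And>i. i < m \<Longrightarrow> A i \<in> UT n"
    and "probability_vector m w" "Suc p < n"
  defines "a \<equiv> (\<lambda>i. mat_inv (diag_part X) * A i)"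
  defines "f \<equiv> (\<lambda>i. log_quot (a i $$ (Suc p, Suc p)) (a i $$ (p, p)))"
  shows "X $$ (p, Suc p) = X $$ (p, p) * (\<Sum>i<m. w i * f i * a i $$ (p, Suc p))
    / (\<Sum>i<m. w i * f i * a i $$ (Suc p, Suc p))"
proof -
  let ?D = "diag_part X"
  have D: "?D \<in> UT n"
    by (rule UT_diag_part[OF assms(2)])
  have p: "p < n" using assms(5) by simp
  have X: "X $$ (p, p) > 0" "X $$ (Suc p, Suc p) > 0"
    using UT_diagonal_pos[OF assms(2)] p assms(5) by auto
  have a_UT: "a i \<in> UT n" if "i < m" for i
    unfolding a_def using UT_mult(1)[OF UT_mat_inv(1)[OF D] assms(3)] that .
  have a_pos: "a i $$ (p, p) > 0" "a i $$ (Suc p, Suc p) > 0" if "i < m" for i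
    using UT_diagonal_pos[OF a_UT[OF that]] p assms(5) by auto
  have a_diagonal: "a i $$ (q, q) = A i $$ (q, q) / X $$ (q, q)" if "i < m" "q < n" for i q
    using UT_mult_diagonal[OF UT_mat_inv(1)[OF D] assms(3)] UT_mat_inv_diagonal[OF D]
      diag_part_index[OF assms(2)] that
    by (simp add: a_def)
  have a_super: "a i $$ (p, Suc p) = A i $$ (p, Suc p) / X $$ (p, p)" if "i < m" for i
    using UT_mult_superdiagonal[OF UT_mat_inv(1)[OF D] assms(3)] UT_mat_inv_diagonal[OF D]
      UT_mat_inv_superdiagonal[OF D] diag_part_index[OF assms(2)] that p assms(5)
    by (simp add: a_def)
  have log: "mat_log (mat_inv X * A i) $$ (p, Suc p)
      = f i * (a i $$ (p, Suc p) - X $$ (p, Suc p) / X $$ (p, p) * a i $$ (Suc p, Suc p))"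
    if i: "i < m" for i
  proof -
    note inv = UT_mat_inv(1)[OF assms(2)]
    have diagonal: "(mat_inv X * A i) $$ (q, q) = a i $$ (q, q)" if "q < n" for q
      using UT_mult_diagonal[OF inv assms(3)[OF i] that] UT_mat_inv_diagonal[OF assms(2) that]
        a_diagonal[OF i that] by simp
    have "(mat_inv X * A i) $$ (p, Suc p)
        = a i $$ (p, Suc p) - X $$ (p, Suc p) / X $$ (p, p) * a i $$ (Suc p, Suc p)"
      using UT_mult_superdiagonal[OF inv assms(3)[OF i] assms(5)] UT_mat_inv_diagonal[OF assms(2) p]
        UT_mat_inv_superdiagonal[OF assms(2,5)] a_diagonal[OF i assms(5)] a_super[OF i] by simp
    then show ?thesis
      using mat_log_superdiagonal[OF UT_mult(1)[OF inv assms(3)[OF i]] assms(5)]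
        diagonal[OF p] diagonal[OF assms(5)]
      by (simp add: f_def)
  qed
  define S where "S = (\<Sum>i<m. w i * f i * a i $$ (Suc p, Suc p))"
  have "0 = (\<Sum>i<m. w i * (f i * (a i $$ (p, Suc p) - X $$ (p, Suc p) / X $$ (p, p) * a i $$ (Suc p, Suc p))))"
    using karcher_solution_entry[OF assms(1-3) p assms(5)] log by simp
  also have "\<dots> = (\<Sum>i<m. w i * f i * a i $$ (p, Suc p)) - X $$ (p, Suc p) / X $$ (p, p) * S"
    unfolding S_def by (simp add: algebra_simps sum_subtractf sum_distrib_left)
  finally have eq: "X $$ (p, Suc p) * S = X $$ (p, p) * (\<Sum>i<m. w i * f i * a i $$ (p, Suc p))"
    using X by (simp add: field_simps)
  have "S > 0"
  proof -
    have w: "w i \<ge> 0" if "i < m" for i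
      using assms(4) that by (simp add: probability_vector_def)
    have pos: "f i * a i $$ (Suc p, Suc p) > 0" if "i < m" for i
      using a_pos[OF that] by (simp add: f_def log_quot_pos)
    \<comment> \<open>Single weights may vanish, but their sum is 1, so some weight is positive and
      the denominator \<open>S\<close> has a positive term.\<close>
    have "\<exists>i<m. w i \<noteq> 0"
      using assms(4) by (auto simp: probability_vector_def intro: ccontr)
    then obtain i where i: "i < m" "w i > 0"
      using w by (metis order_le_imp_less_or_eq)
    have "0 < w i * (f i * a i $$ (Suc p, Suc p))"
      using i pos by simp
    moreover have "0 \<le> w i * (f i * a i $$ (Suc p, Suc p))" if "i < m" for i
      using w[OF that] pos[OF that] by simp
    ultimately show ?thesis
      unfolding S_def using i by (intro sum_pos2[of _ i]) (auto simp: mult.assoc)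
  qed
  then show ?thesis
    unfolding S_def[symmetric] using eq by (simp add: eq_divide_eq)
qed

theorem theorem4p2:
  fixes n m :: nat and w :: "nat \<Rightarrow> real" and A :: "nat \<Rightarrow> real mat" and X :: "real mat"
  assumes "n \<ge> 2" and "m \<ge> 2"
    and "probability_vector m w"
    and "\<And>i. i < m \<Longrightarrow> A i \<in> UT n"
    and "X \<in> UT n"
    and "karcher_solution n m w A X"
  shows "let D = diag_part (ordered_prod n m (\<lambda>i. mat_powr (A i) (w i)));
             d = (\<lambda>p. D $$ (p, p));
             a = (\<lambda>i. mat_inv D * A i)
         in diag_part X = D \<and>
            (\<forall>p. p + 1 < n \<longrightarrow>
              X $$ (p, p + 1) =
                (d p * (\<Sum>i<m. w i * log_quot (a i $$ (p + 1, p + 1)) (a i $$ (p, p)) * a i $$ (p, p + 1)))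
                / (\<Sum>i<m. w i * log_quot (a i $$ (p + 1, p + 1)) (a i $$ (p, p)) * a i $$ (p + 1, p + 1)))"
proof -
  let ?P = "ordered_prod n m (\<lambda>i. mat_powr (A i) (w i))"
  have P: "?P \<in> UT n"
    using UT_mat_powr(1)[OF assms(4)] by (rule UT_ordered_prod(1))
  have diagonal: "X $$ (p, p) = ?P $$ (p, p)" if "p < n" for p
  proof -
    have "?P $$ (p, p) = (\<Prod>i<m. mat_powr (A i) (w i) $$ (p, p))"
      using UT_mat_powr(1)[OF assms(4)] that by (rule ordered_prod_diagonal)
    then show ?thesis
      using karcher_solution_diagonal[OF assms(6,5,4,3) that] mat_powr_diagonal[OF assms(4) that]
      by simp
  qed
  \<comment> \<open>Identifies \<open>D\<close> with \<open>diag_part X\<close>, the form in which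
    the superdiagonal formula was derived.\<close>
  have D: "diag_part X = diag_part ?P"
    using UT_carrier[OF P] UT_carrier[OF assms(5)] diagonal
    by (auto simp: diag_part_def mat_diag_def intro!: eq_matI)
  have "X $$ (p, p) = diag_part ?P $$ (p, p)" if "p < n" for p
    using diag_part_index[OF P that that] diagonal[OF that] by simp
  then show ?thesis
    unfolding Let_def
    using D karcher_solution_superdiagonal[OF assms(6,5,4,3)] by simp
qed

end
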